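(* Let $P=(V,\preceq)$ be a Borel poset of finite height $h$. Then $V$ can be decomposed into $h$ antichains of $P$, each of which is a measurable subset of $V$.
   Context: A Borel poset is a poset $(V,\preceq)$ where $V$ is a standard Borel space and the relation $\preceq$ is a Borel subset of $V\times V$. The height of a poset is the largest size of a chain in it. "Measurable" is understood as universally measurable, i.e. measurable with respect to the completion of every Borel probability measure on $V$ (the class of sets containing projections of Borel sets, i.e. analytic sets, and closed under complements and countable unions and intersections). *)

theory Defs
  imports "HOL-Probability.Probability"
begin

text \<open>As in the library, a measurable space is a value of type \<open>'a measure\<close> of which only
  \<open>space\<close> and \<open>sets\<close> are used.\<close>

definition polish_topology :: "'a topology \<Rightarrow> bool" where
  "polish_topology X \<longleftrightarrow> completely_metrizable_space X \<and> separable_space X"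

definition standard_borel :: "'a measure \<Rightarrow> bool" where
  "standard_borel V \<longleftrightarrow>
     (\<exists>X. polish_topology X \<and> topspace X = space V \<and>
          sets V = sigma_sets (topspace X) {U. openin X U})"

definition universally_measurable :: "'a measure \<Rightarrow> 'a set \<Rightarrow> bool" where
  "universally_measurable V A \<longleftrightarrow>
     A \<subseteq> space V \<and>
     (\<forall>\<mu>. prob_space \<mu> \<and> sets \<mu> = sets V \<longrightarrow> A \<in> sets (completion \<mu>))"

definition borel_poset :: "'a measure \<Rightarrow> 'a rel \<Rightarrow> bool" where
  "borel_poset V r \<longleftrightarrow>
     standard_borel V \<and> partial_order_on (space V) r \<and> r \<in> sets (V \<Otimes>\<^sub>M V)"

text \<open>A partial order on a set relates no points outside it, so every member of \<open>Chains r\<close>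
  lies in the carrier.\<close>

definition has_height :: "'a rel \<Rightarrow> nat \<Rightarrow> bool" where
  "has_height r h \<longleftrightarrow>
     (\<exists>C\<in>Chains r. finite C \<and> card C = h) \<and>
     (\<forall>C\<in>Chains r. finite C \<and> card C \<le> h)"

definition antichain :: "'a rel \<Rightarrow> 'a set \<Rightarrow> bool" where
  "antichain r A \<longleftrightarrow> (\<forall>x\<in>A. \<forall>y\<in>A. x \<noteq> y \<longrightarrow> (x, y) \<notin> r \<and> (y, x) \<notin> r)"

end

theory Submission
  imports Defs
begin

text \<open>The antichains can even be chosen Borel. In a Borel set \<open>W\<close> of height \<open>h + 1\<close>, the top elements of
  chains of size \<open>h + 1\<close> and the non-maximal elements form two disjoint projections of Borel sets
  of tuples. By Lusin's separation theorem some Borel set \<open>S\<close> contains the former and misses the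
  latter. Then \<open>W \<inter> S\<close> consists of maximal elements of \<open>W\<close>, so it is an antichain, and every
  chain of size \<open>h + 1\<close> in \<open>W\<close> has its top in \<open>S\<close>, so \<open>W - S\<close> has height at most \<open>h\<close>.
  For the separation theorem, a pair of non-separable images is cut into countably many pairs of
  small pieces, one of which is again non-separable; iterating, the pieces shrink to two points,
  whose distinct values have disjoint open neighbourhoods, a contradiction.\<close>

section \<open>Second countability and Polish products\<close>

text \<open>The balls of radius \<open>1 / (n + 1)\<close> about the points of a countable dense set
  form a base.\<close>

lemma second_countable_mtopology:
  assumes "Metric_space M d" and "separable_space (Metric_space.mtopology M d)"
  shows "second_countable (Metric_space.mtopology M d)"
proof -
  interpret Metric_space M d by fact
  obtain C where C: "countable C" "C \<subseteq> M" "mtopology closure_of C = M"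
    using assms(2) unfolding separable_space_def by auto
  define B where "B = (\<lambda>(c, n). mball c (inverse (real (Suc n)))) ` (C \<times> UNIV)"
  have "\<exists>V\<in>B. x \<in> V \<and> V \<subseteq> U" if U: "openin mtopology U" "x \<in> U" for U x
  proof -
    obtain r where r: "r > 0" "mball x r \<subseteq> U" and x: "x \<in> M"
      using U unfolding openin_mtopology by blast
    obtain n where n: "inverse (real (Suc n)) < r / 2"
      using reals_Archimedean[of "r / 2"] r by auto
    have "x \<in> mtopology closure_of C"
      using x C by simp
    then obtain c where c: "c \<in> C" "c \<in> mball x (inverse (real (Suc n)))"
      unfolding metric_closure_of using of_nat_0_less_iff positive_imp_inverse_positive by blast
    have "mball c (inverse (real (Suc n))) \<subseteq> mball x r"
    proof
      fix y assume "y \<in> mball c (inverse (real (Suc n)))"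
      moreover have "d x y \<le> d x c + d c y" if "y \<in> M"
        using that c x by (intro triangle) auto
      ultimately show "y \<in> mball x r"
        using c n by auto
    qed
    moreover have "x \<in> mball c (inverse (real (Suc n)))"
      using c(2) by (simp add: commute)
    ultimately show ?thesis
      using r c(1) unfolding B_def by blast
  qed
  moreover have "countable B"
    unfolding B_def using C by auto
  moreover have "\<forall>V\<in>B. openin mtopology V"
    unfolding B_def by auto
  ultimately show ?thesis
    unfolding second_countable_def by meson
qed

lemma second_countable_prod_topology:
  assumes "second_countable X" and "second_countable Y"
  shows "second_countable (prod_topology X Y)"
proof -
  obtain A where A: "countable A" "\<And>U. U \<in> A \<Longrightarrow> openin X U"
    "\<And>U x. openin X U \<Longrightarrow> x \<in> U \<Longrightarrow> \<exists>V\<in>A. x \<in> V \<and> V \<subseteq> U"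
    using assms(1) unfolding second_countable_def by metis
  obtain B where B: "countable B" "\<And>U. U \<in> B \<Longrightarrow> openin Y U"
    "\<And>U x. openin Y U \<Longrightarrow> x \<in> U \<Longrightarrow> \<exists>V\<in>B. x \<in> V \<and> V \<subseteq> U"
    using assms(2) unfolding second_countable_def by metis
  let ?D = "(\<lambda>(U, V). U \<times> V) ` (A \<times> B)"
  have "\<exists>V\<in>?D. p \<in> V \<and> V \<subseteq> U" if U: "openin (prod_topology X Y) U" "p \<in> U" for U p
  proof -
    obtain x y where p: "p = (x, y)" by (cases p)
    then obtain G H where "openin X G" "openin Y H" "x \<in> G" "y \<in> H" "G \<times> H \<subseteq> U"
      using U unfolding openin_prod_topology_alt by meson
    moreover from this obtain G' H' where "G' \<in> A" "x \<in> G'" "G' \<subseteq> G" "H' \<in> B" "y \<in> H'" "H' \<subseteq> H"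
      using A(3) B(3) by meson
    ultimately show ?thesis
      using p by (intro bexI[of _ "G' \<times> H'"]) auto
  qed
  moreover have "countable ?D"
    using A(1) B(1) by auto
  moreover have "\<forall>V\<in>?D. openin (prod_topology X Y) V"
    using A(2) B(2) by (auto simp: openin_prod_Times_iff)
  ultimately show ?thesis
    unfolding second_countable_def by meson
qed

lemma second_countable_product_topology:
  assumes "countable I" and "\<And>i. i \<in> I \<Longrightarrow> second_countable (X i)"
  shows "second_countable (product_topology X I)"
proof -
  have "\<forall>i\<in>I. \<exists>B. countable B \<and> (\<forall>U\<in>B. openin (X i) U) \<and>
      (\<forall>U x. openin (X i) U \<and> x \<in> U \<longrightarrow> (\<exists>V\<in>B. x \<in> V \<and> V \<subseteq> U))"
    using assms(2) unfolding second_countable_def by blast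
  then obtain B where B: "\<And>i. i \<in> I \<Longrightarrow> countable (B i)"
    "\<And>i U. i \<in> I \<Longrightarrow> U \<in> B i \<Longrightarrow> openin (X i) U"
    "\<And>i U x. i \<in> I \<Longrightarrow> openin (X i) U \<Longrightarrow> x \<in> U \<Longrightarrow> \<exists>V\<in>B i. x \<in> V \<and> V \<subseteq> U"
    by metis
  let ?T = "topspace (product_topology X I)"
  \<comment> \<open>A finite set \<open>P\<close> of pairs (index, basic open set) encodes a
    cylinder. The factor \<open>?T\<close> makes the cylinder of the empty \<open>P\<close> the
    whole space.\<close>
  define box where "box P = ?T \<inter> (\<Inter>(i, U)\<in>P. {x \<in> ?T. x i \<in> U})" for P
  let ?D = "box ` {P. finite P \<and> P \<subseteq> Sigma I B}"
  have "openin (product_topology X I) (box P)" if "finite P" "P \<subseteq> Sigma I B" for P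
  proof -
    have "openin (product_topology X I) {x \<in> ?T. x i \<in> U}" if "(i, U) \<in> P" for i U
      using that \<open>P \<subseteq> Sigma I B\<close> B(2)
      by (intro openin_continuous_map_preimage[OF continuous_map_product_projection]) auto
    then have "openin (product_topology X I) ((\<Inter>(i, U)\<in>P. {x \<in> ?T. x i \<in> U}) \<inter> ?T)"
      using \<open>finite P\<close> by (cases "P = {}") (auto intro!: openin_Inter openin_Int simp del: topspace_product_topology)
    then show ?thesis
      unfolding box_def by (simp add: Int_commute)
  qed
  then have "\<forall>V\<in>?D. openin (product_topology X I) V"
    by auto
  moreover have "countable ?D"
    using assms(1) B(1) by (intro countable_image countable_Collect_finite_subset) auto
  moreover have "\<exists>V\<in>?D. x \<in> V \<and> V \<subseteq> U" if U: "openin (product_topology X I) U" "x \<in> U" for U x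
  proof -
    obtain G where G: "finite {i \<in> I. G i \<noteq> topspace (X i)}" "\<And>i. i \<in> I \<Longrightarrow> openin (X i) (G i)"
      "x \<in> Pi\<^sub>E I G" "Pi\<^sub>E I G \<subseteq> U"
      using U unfolding openin_product_topology_alt by meson
    have "\<forall>i\<in>I. \<exists>V\<in>B i. x i \<in> V \<and> V \<subseteq> G i"
      using B(3) G(2,3) by (meson PiE_mem)
    then obtain H where H: "\<And>i. i \<in> I \<Longrightarrow> H i \<in> B i \<and> x i \<in> H i \<and> H i \<subseteq> G i"
      by metis
    \<comment> \<open>Only the finitely many coordinates that \<open>G\<close> really restricts are
      recorded; on the others, membership in \<open>?T\<close> already gives membership in
      \<open>G i\<close>.\<close>
    define P where "P = (\<lambda>i. (i, H i)) ` {i \<in> I. G i \<noteq> topspace (X i)}"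
    have "x \<in> ?T"
      using U openin_subset by blast
    then have "x \<in> box P"
      unfolding box_def P_def using H by auto
    moreover have "box P \<subseteq> Pi\<^sub>E I G"
    proof
      fix y assume y: "y \<in> box P"
      then have "y \<in> ?T" by (simp add: box_def)
      moreover have "y i \<in> G i" if "i \<in> I" for i
        using y that H[OF that] \<open>y \<in> ?T\<close>
        by (cases "G i = topspace (X i)") (auto simp: box_def P_def)
      ultimately show "y \<in> Pi\<^sub>E I G"
        by (auto simp: PiE_iff)
    qed
    moreover have "finite P" "P \<subseteq> Sigma I B"
      unfolding P_def using G(1) H by auto
    ultimately show ?thesis
      using G(4) by (intro bexI[of _ "box P"] conjI imageI CollectI) auto
  qed
  ultimately show ?thesis
    unfolding second_countable_def by meson
qed

text \<open>Trades separability for second countability, which passes to products by combining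
  bases.\<close>

lemma polish_topology_alt:
  "polish_topology X \<longleftrightarrow> completely_metrizable_space X \<and> second_countable X"
proof -
  have "second_countable X" if X: "completely_metrizable_space X" "separable_space X"
  proof -
    obtain M d where "Metric_space M d" "X = Metric_space.mtopology M d"
      using X(1) unfolding completely_metrizable_space_def by blast
    then show ?thesis
      using X(2) second_countable_mtopology by simp
  qed
  then show ?thesis
    using second_countable_imp_separable_space polish_topology_def by blast
qed

lemma polish_topology_prod_topology:
  "polish_topology X \<Longrightarrow> polish_topology Y \<Longrightarrow> polish_topology (prod_topology X Y)"
  by (simp add: polish_topology_alt completely_metrizable_space_prod_topology
      second_countable_prod_topology)

lemma polish_topology_product_topology:
  assumes "countable I" and "\<And>i. i \<in> I \<Longrightarrow> polish_topology (X i)"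
  shows "polish_topology (product_topology X I)"
  using assms
  by (auto simp: polish_topology_alt completely_metrizable_space_product_topology
      intro!: second_countable_product_topology)

section \<open>Lusin's separation theorem\<close>

text \<open>Balls about a countable dense set cover the space. They are taken closed so that cutting
  a closed set with them leaves closed pieces, as Cantor's intersection theorem requires.\<close>

lemma (in Metric_space) countable_closed_cover:
  assumes "separable_space mtopology" and "e > 0"
  shows "\<exists>K :: nat \<Rightarrow> 'a set. (\<forall>i. closedin mtopology (K i) \<and> (\<exists>a. K i \<subseteq> mcball a e)) \<and> (\<Union>i. K i) = M"
proof -
  obtain C where C: "countable C" "C \<subseteq> M" "mtopology closure_of C = M"
    using assms(1) unfolding separable_space_def by auto
  \<comment> \<open>For empty \<open>M\<close> the enumeration returns an arbitrary value, but a
    ball about a point outside \<open>M\<close> is empty, so the cover remains correct.\<close>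
  define K where "K i = mcball (from_nat_into C i) e" for i
  have "x \<in> (\<Union>i. K i)" if "x \<in> M" for x
  proof -
    have "x \<in> mtopology closure_of C"
      using that C by simp
    then obtain c where c: "c \<in> C" "c \<in> mcball x e"
      unfolding metric_closure_of_alt using assms(2) by blast
    then obtain i where "from_nat_into C i = c"
      using C(1) from_nat_into_surj by metis
    then have "x \<in> K i"
      using c by (simp add: K_def commute)
    then show ?thesis by blast
  qed
  then have "(\<Union>i. K i) = M"
    by (auto simp: K_def)
  then show ?thesis
    by (intro exI[of _ K]) (auto simp: K_def)
qed

text \<open>Working with continuous images of closed sets moves the splitting into the complete
  spaces \<open>Z\<close> and \<open>W\<close>, where nested nonempty closed sets of vanishing size
  have a common point.\<close>

lemma lusin_separation:
  fixes f :: "'z \<Rightarrow> 'a" and g :: "'w \<Rightarrow> 'a"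
  assumes "polish_topology Z" and "polish_topology W"
    and "Hausdorff_space X" and V: "\<And>U. openin X U \<Longrightarrow> U \<in> sets V"
    and f: "continuous_map Z X f" and g: "continuous_map W X g"
    and C: "closedin Z C" and D: "closedin W D" and disj: "f ` C \<inter> g ` D = {}"
  shows "\<exists>S\<in>sets V. f ` C \<subseteq> S \<and> S \<inter> g ` D = {}"
proof (rule ccontr)
  define sep where "sep A B \<longleftrightarrow> (\<exists>S\<in>sets V. A \<subseteq> S \<and> S \<inter> B = {})" for A B :: "'a set"
  assume "\<not> ?thesis"
  then have nsep: "\<not> sep (f ` C) (g ` D)"
    by (simp add: sep_def)
  obtain M d where "Metric_space M d" and M: "Metric_space.mcomplete M d" "Z = Metric_space.mtopology M d"
    using assms(1) unfolding polish_topology_def completely_metrizable_space_def by blast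
  obtain N e where "Metric_space N e" and N: "Metric_space.mcomplete N e" "W = Metric_space.mtopology N e"
    using assms(2) unfolding polish_topology_def completely_metrizable_space_def by blast
  interpret Z: Metric_space M d by fact
  interpret W: Metric_space N e by fact
  have sepZ: "separable_space Z.mtopology" and sepW: "separable_space W.mtopology"
    using assms(1,2) M N by (auto simp: polish_topology_def)
  \<comment> \<open>For fixed \<open>i\<close>, the intersection of \<open>S i j\<close> over
    \<open>j\<close> still contains \<open>A i\<close> and misses every \<open>B j\<close>; the
    union over \<open>i\<close> then separates the two unions.\<close>
  have sep_UN: "sep (\<Union>i. A i) (\<Union>j. B j)" if AB: "\<And>i j. sep (A i) (B j)"
    for A B :: "nat \<Rightarrow> 'a set"
  proof -
    obtain S where S: "\<And>i j. S i j \<in> sets V \<and> A i \<subseteq> S i j \<and> S i j \<inter> B j = {}"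
      using AB unfolding sep_def by metis
    have "(\<Union>i. \<Inter>j. S i j) \<in> sets V"
      using S by (intro sets.countable_UN sets.countable_INT) auto
    moreover have "(\<Union>i. A i) \<subseteq> (\<Union>i. \<Inter>j. S i j)" "(\<Union>i. \<Inter>j. S i j) \<inter> (\<Union>j. B j) = {}"
      using S by blast+
    ultimately show ?thesis
      unfolding sep_def by blast
  qed
  have shrink: "\<exists>A' B'. closedin Z A' \<and> closedin W B' \<and> \<not> sep (f ` A') (g ` B') \<and> A' \<subseteq> A \<and> B' \<subseteq> B \<and>
      (\<exists>a. A' \<subseteq> Z.mcball a r) \<and> (\<exists>b. B' \<subseteq> W.mcball b r)"
    if AB: "closedin Z A" "closedin W B" "\<not> sep (f ` A) (g ` B)" and "r > 0" for A B r
  proof -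
    obtain K :: "nat \<Rightarrow> _" where K: "\<forall>i. closedin Z.mtopology (K i) \<and> (\<exists>a. K i \<subseteq> Z.mcball a r)" "(\<Union>i. K i) = M"
      using Z.countable_closed_cover[OF sepZ \<open>r > 0\<close>] by (elim exE conjE)
    obtain L :: "nat \<Rightarrow> _" where L: "\<forall>i. closedin W.mtopology (L i) \<and> (\<exists>a. L i \<subseteq> W.mcball a r)" "(\<Union>i. L i) = N"
      using W.countable_closed_cover[OF sepW \<open>r > 0\<close>] by (elim exE conjE)
    have "A \<subseteq> M" "B \<subseteq> N"
      using AB M N closedin_subset by fastforce+
    then have eq: "f ` A = (\<Union>i. f ` (A \<inter> K i))" "g ` B = (\<Union>j. g ` (B \<inter> L j))"
      unfolding image_UN[symmetric] Int_UN_distrib[symmetric] K(2) L(2) by (simp_all add: Int_absorb2)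
    have "\<not> sep (\<Union>i. f ` (A \<inter> K i)) (\<Union>j. g ` (B \<inter> L j))"
      using AB(3) by (simp only: eq[symmetric]) simp
    then obtain i j where "\<not> sep (f ` (A \<inter> K i)) (g ` (B \<inter> L j))"
      using sep_UN[of "\<lambda>i. f ` (A \<inter> K i)" "\<lambda>j. g ` (B \<inter> L j)"] by blast
    moreover have "closedin Z (A \<inter> K i)" "closedin W (B \<inter> L j)"
      using AB(1,2) K(1) L(1) M(2) N(2) by auto
    moreover have "\<exists>a. A \<inter> K i \<subseteq> Z.mcball a r" "\<exists>b. B \<inter> L j \<subseteq> W.mcball b r"
      using K(1) L(1) by (meson Int_lower2 subset_trans)+
    ultimately show ?thesis
      by (intro exI[of _ "A \<inter> K i"] exI[of _ "B \<inter> L j"]) simp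
  qed
  \<comment> \<open>Dependent choice runs on pairs of closed sets with inseparable images. The size
    bound sits in the transition \<open>Q\<close>, since the initial pair \<open>(C, D)\<close> may
    be unbounded: it is \<open>F (Suc n)\<close> that fits into balls of radius
    \<open>1 / (n + 1)\<close>.\<close>
  define P where "P p \<longleftrightarrow> closedin Z (fst p) \<and> closedin W (snd p) \<and> \<not> sep (f ` fst p) (g ` snd p)
      \<and> fst p \<subseteq> C \<and> snd p \<subseteq> D" for p :: "'z set \<times> 'w set"
  define Q where "Q n p p' \<longleftrightarrow> fst p' \<subseteq> fst p \<and> snd p' \<subseteq> snd p \<and>
      (\<exists>a. fst p' \<subseteq> Z.mcball a (inverse (real (Suc n)))) \<and>
      (\<exists>b. snd p' \<subseteq> W.mcball b (inverse (real (Suc n))))"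
    for n and p p' :: "'z set \<times> 'w set"
  have "\<exists>F. \<forall>n. P (F n) \<and> Q n (F n) (F (Suc n))"
  proof (rule dependent_nat_choice)
    show "\<exists>p. P p"
      using C D nsep by (intro exI[of _ "(C, D)"]) (simp add: P_def)
  next
    fix p n assume "P p"
    moreover have "inverse (real (Suc n)) > 0" by simp
    ultimately obtain A' B' where "closedin Z A'" "closedin W B'" "\<not> sep (f ` A') (g ` B')"
      "A' \<subseteq> fst p" "B' \<subseteq> snd p" "\<exists>a. A' \<subseteq> Z.mcball a (inverse (real (Suc n)))"
      "\<exists>b. B' \<subseteq> W.mcball b (inverse (real (Suc n)))"
      unfolding P_def using shrink by meson
    with \<open>P p\<close> show "\<exists>p'. P p' \<and> Q n p p'"
      by (intro exI[of _ "(A', B')"]) (auto simp: P_def Q_def)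
  qed
  then obtain F where F: "\<And>n. P (F n)" "\<And>n. Q n (F n) (F (Suc n))"
    by blast
  define A where "A n = fst (F n)" for n
  define B where "B n = snd (F n)" for n
  have A: "closedin Z (A n)" "A (Suc n) \<subseteq> A n" "\<exists>a. A (Suc n) \<subseteq> Z.mcball a (inverse (real (Suc n)))"
    and B: "closedin W (B n)" "B (Suc n) \<subseteq> B n" "\<exists>a. B (Suc n) \<subseteq> W.mcball a (inverse (real (Suc n)))"
    and AB: "\<not> sep (f ` A n) (g ` B n)" "A n \<subseteq> C" "B n \<subseteq> D" for n
    using F[of n] by (auto simp: A_def B_def P_def Q_def)
  \<comment> \<open>Cantor's theorem needs nonempty sets. An empty image could be separated, by
    \<open>{}\<close> if it is the first one and by \<open>topspace X\<close> if it is the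
    second.\<close>
  have ne: "A n \<noteq> {}" "B n \<noteq> {}" for n
  proof -
    have "f ` A n \<subseteq> topspace X"
      using closedin_subset[OF A(1)[of n]] continuous_map_image_subset_topspace[OF f] by blast
    then have "sep {} (g ` B n)" "sep (f ` A n) {}"
      unfolding sep_def using V[OF openin_topspace] by blast+
    then show "A n \<noteq> {}" "B n \<noteq> {}"
      using AB(1)[of n] by auto
  qed
  have dec: "decseq A" "decseq B"
    using A(2) B(2) by (simp_all add: decseq_SucI)
  have small: "\<forall>r>0. \<exists>n a. A n \<subseteq> Z.mcball a r" "\<forall>r>0. \<exists>n a. B n \<subseteq> W.mcball a r"
  proof -
    have "\<exists>n. (\<exists>a. A n \<subseteq> Z.mcball a r) \<and> (\<exists>b. B n \<subseteq> W.mcball b r)" if r: "r > 0" for r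
    proof -
      obtain n where n: "inverse (real (Suc n)) < r"
        using reals_Archimedean r by blast
      then have "Z.mcball a (inverse (real (Suc n))) \<subseteq> Z.mcball a r"
        "W.mcball b (inverse (real (Suc n))) \<subseteq> W.mcball b r" for a b
        by auto
      then show ?thesis
        using A(3)[of n] B(3)[of n] by (meson subset_trans)
    qed
    then show "\<forall>r>0. \<exists>n a. A n \<subseteq> Z.mcball a r" "\<forall>r>0. \<exists>n a. B n \<subseteq> W.mcball a r"
      by meson+
  qed
  \<comment> \<open>Completeness in the form of Cantor's intersection theorem yields the limit
    points \<open>z\<close> and \<open>w\<close>.\<close>
  have "\<Inter> (range A) \<noteq> {}"
    using M(1)[unfolded Z.mcomplete_nest, rule_format, of A] A(1) ne(1) dec(1) small(1) M(2) by simp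
  then obtain z where z: "\<And>n. z \<in> A n"
    by blast
  have "\<Inter> (range B) \<noteq> {}"
    using N(1)[unfolded W.mcomplete_nest, rule_format, of B] B(1) ne(2) dec(2) small(2) N(2) by simp
  then obtain w where w: "\<And>n. w \<in> B n"
    by blast
  have zM: "z \<in> M" and wN: "w \<in> N"
    using z[of 0] w[of 0] closedin_subset[OF A(1)] closedin_subset[OF B(1)] M N by auto
  have "f z \<noteq> g w"
    using z[of 0] w[of 0] AB(2,3)[of 0] disj by blast
  moreover have "f z \<in> topspace X" "g w \<in> topspace X"
    using f g zM wN M N by (auto simp: continuous_map_def Pi_iff)
  ultimately obtain G H where GH: "openin X G" "openin X H" "f z \<in> G" "g w \<in> H" "disjnt G H"
    using assms(3) unfolding Hausdorff_space_def by meson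
  have "openin Z.mtopology {x \<in> M. f x \<in> G}" "openin W.mtopology {x \<in> N. g x \<in> H}"
    using openin_continuous_map_preimage[OF f GH(1)] openin_continuous_map_preimage[OF g GH(2)] M(2) N(2)
    by simp_all
  then have "\<exists>r>0. Z.mball z r \<subseteq> {x \<in> M. f x \<in> G}" "\<exists>s>0. W.mball w s \<subseteq> {x \<in> N. g x \<in> H}"
    using zM wN GH(3,4) unfolding Z.openin_mtopology W.openin_mtopology by simp_all
  then obtain r s where r: "r > 0" "Z.mball z r \<subseteq> {x \<in> M. f x \<in> G}"
    and s: "s > 0" "W.mball w s \<subseteq> {x \<in> N. g x \<in> H}"
    by (elim exE conjE)
  \<comment> \<open>The factor 2 is for the triangle inequality through the centre of the ball,
    which need not be \<open>z\<close> or \<open>w\<close>. At this stage \<open>G\<close> separates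
    the two images.\<close>
  obtain n where n: "inverse (real (Suc n)) < min r s / 2"
    using reals_Archimedean[of "min r s / 2"] r s by auto
  obtain a b where a: "A (Suc n) \<subseteq> Z.mcball a (inverse (real (Suc n)))"
    and b: "B (Suc n) \<subseteq> W.mcball b (inverse (real (Suc n)))"
    using A(3) B(3) by blast
  have "A (Suc n) \<subseteq> Z.mball z r"
  proof
    fix x assume "x \<in> A (Suc n)"
    then have "x \<in> Z.mcball a (inverse (real (Suc n)))" "z \<in> Z.mcball a (inverse (real (Suc n)))"
      using a z by blast+
    moreover from this have "d z x \<le> d z a + d a x"
      by (intro Z.triangle) auto
    ultimately show "x \<in> Z.mball z r"
      using n by (auto simp: Z.commute)
  qed
  moreover have "B (Suc n) \<subseteq> W.mball w s"
  proof
    fix x assume "x \<in> B (Suc n)"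
    then have "x \<in> W.mcball b (inverse (real (Suc n)))" "w \<in> W.mcball b (inverse (real (Suc n)))"
      using b w by blast+
    moreover from this have "e w x \<le> e w b + e b x"
      by (intro W.triangle) auto
    ultimately show "x \<in> W.mball w s"
      using n by (auto simp: W.commute)
  qed
  ultimately have "f ` A (Suc n) \<subseteq> G" "g ` B (Suc n) \<subseteq> H"
    using r(2) s(2) by blast+
  then have "sep (f ` A (Suc n)) (g ` B (Suc n))"
    unfolding sep_def using GH V by (intro bexI[of _ G]) (auto simp: disjnt_def)
  then show False
    using AB(1) by blast
qed

section \<open>Analytic sets as projections along Baire space\<close>

text \<open>Baire space serves as the space of witnesses: one sequence can store a number together
  with a sequence, or countably many sequences.\<close>

definition baire :: "(nat \<Rightarrow> nat) topology" where
  "baire = product_topology (\<lambda>_. discrete_topology UNIV) UNIV"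

lemma topspace_baire [simp]: "topspace baire = UNIV"
  by (simp add: baire_def)

lemma polish_topology_baire: "polish_topology baire"
  unfolding baire_def
  by (intro polish_topology_product_topology)
    (auto simp: polish_topology_alt completely_metrizable_space_discrete_topology
      second_countable_discrete_topology)

lemma continuous_map_baire_reindex: "continuous_map baire baire (\<lambda>s n. s (p n))"
  unfolding baire_def continuous_map_componentwise_UNIV
  by (auto intro: continuous_map_product_projection)

text \<open>For Polish \<open>X\<close> these are the analytic sets. Projections of closed sets have
  exactly the form that the separation theorem accepts, with \<open>fst\<close> as the continuous
  map.\<close>

definition suslin :: "'a topology \<Rightarrow> 'a set \<Rightarrow> bool" where
  "suslin X A \<longleftrightarrow> (\<exists>C. closedin (prod_topology X baire) C \<and> A = fst ` C)"

lemma closedin_imp_suslin: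
  assumes "closedin X A"
  shows "suslin X A"
proof -
  have "closedin (prod_topology X baire) (A \<times> UNIV)"
    using assms closedin_topspace[of baire] by (simp add: closedin_prod_Times_iff)
  then show ?thesis
    unfolding suslin_def by (intro exI[of _ "A \<times> UNIV"]) auto
qed

text \<open>Extracting a subsequence of the witness is continuous. It is used for the tail of a
  sequence and for one row of an encoded double sequence.\<close>

lemma closedin_reindex:
  assumes "closedin (prod_topology X baire) C"
  shows "closedin (prod_topology X baire)
    {q \<in> topspace (prod_topology X baire). (fst q, \<lambda>n. snd q (p n)) \<in> C}"
proof -
  have "continuous_map (prod_topology X baire) baire (\<lambda>q n. snd q (p n))"
    using continuous_map_compose[OF continuous_map_snd continuous_map_baire_reindex]
    by (simp add: o_def)
  then have "continuous_map (prod_topology X baire) (prod_topology X baire)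
      (\<lambda>q. (fst q, \<lambda>n. snd q (p n)))"
    by (intro continuous_map_pairedI continuous_map_fst)
  then show ?thesis
    using assms by (rule closedin_continuous_map_preimage)
qed

lemma suslin_UN:
  fixes A :: "nat \<Rightarrow> 'a set"
  assumes "\<And>n. suslin X (A n)"
  shows "suslin X (\<Union>n. A n)"
proof -
  let ?Z = "prod_topology X baire"
  obtain C where C: "\<And>n. closedin ?Z (C n)" "\<And>n. A n = fst ` C n"
    using assms unfolding suslin_def by metis
  \<comment> \<open>Coordinate \<open>0\<close> of the parameter selects the set, the remaining ones are its witness.\<close>
  define E where "E n = {q \<in> topspace ?Z. snd q 0 \<in> - {n}} \<union>
      {q \<in> topspace ?Z. (fst q, \<lambda>k. snd q (Suc k)) \<in> C n}" for n
  have "continuous_map ?Z (discrete_topology UNIV) (\<lambda>q. snd q 0)"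
    using continuous_map_compose[OF continuous_map_snd, of baire "discrete_topology UNIV" "\<lambda>s. s 0" X]
    by (auto simp: baire_def o_def intro: continuous_map_product_projection)
  then have "closedin ?Z {q \<in> topspace ?Z. snd q 0 \<in> - {n}}" for n
    by (rule closedin_continuous_map_preimage) simp
  then have "closedin ?Z (E n)" for n
    unfolding E_def by (intro closedin_Un closedin_reindex C(1))
  \<comment> \<open>Membership in \<open>E n\<close> reads: if the selector is \<open>n\<close>, the
    tail is a witness for \<open>C n\<close>. The intersection over \<open>n\<close> therefore
    expresses a witness for the selected set, and is closed although a union of the
    \<open>C n\<close> need not be.\<close>
  then have "closedin ?Z (\<Inter>n. E n)"
    by (intro closedin_INT) auto
  moreover have "(\<Union>n. A n) = fst ` (\<Inter>n. E n)"
  proof (intro set_eqI iffI)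
    fix x assume "x \<in> (\<Union>n. A n)"
    then obtain n s where xs: "(x, s) \<in> C n"
      using C(2) by auto
    then have "x \<in> topspace X"
      using closedin_subset[OF C(1)] by fastforce
    then have "(x, case_nat n s) \<in> (\<Inter>n. E n)"
      using xs by (auto simp: E_def)
    then show "x \<in> fst ` (\<Inter>n. E n)"
      by force
  next
    fix x assume "x \<in> fst ` (\<Inter>n. E n)"
    then obtain s where "(x, s) \<in> (\<Inter>n. E n)" by force
    then have "(x, s) \<in> E (s 0)" by blast
    then have "(x, \<lambda>k. s (Suc k)) \<in> C (s 0)"
      by (auto simp: E_def)
    then show "x \<in> (\<Union>n. A n)"
      using C(2) by force
  qed
  ultimately show ?thesis
    unfolding suslin_def by blast
qed

lemma suslin_INT:
  fixes A :: "nat \<Rightarrow> 'a set"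
  assumes "\<And>n. suslin X (A n)"
  shows "suslin X (\<Inter>n. A n)"
proof -
  let ?Z = "prod_topology X baire"
  obtain C where C: "\<And>n. closedin ?Z (C n)" "\<And>n. A n = fst ` C n"
    using assms unfolding suslin_def by metis
  \<comment> \<open>A single sequence stores witnesses for all \<open>n\<close> at once: row
    \<open>n\<close> of its decoding by \<open>prod_encode\<close> is the witness for
    \<open>C n\<close>.\<close>
  define E where "E n = {q \<in> topspace ?Z. (fst q, \<lambda>k. snd q (prod_encode (n, k))) \<in> C n}" for n
  have "closedin ?Z (\<Inter>n. E n)"
    unfolding E_def by (intro closedin_INT closedin_reindex C(1)) simp
  moreover have "(\<Inter>n. A n) = fst ` (\<Inter>n. E n)"
  proof (intro set_eqI iffI)
    fix x assume "x \<in> (\<Inter>n. A n)"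
    then have "x \<in> fst ` C n" for n
      using C(2) by blast
    then have "\<exists>s. (x, s) \<in> C n" for n
      by fastforce
    then obtain s where s: "\<And>n. (x, s n) \<in> C n"
      by metis
    then have "x \<in> topspace X"
      using closedin_subset[OF C(1)] by fastforce
    then have "(x, \<lambda>k. case prod_decode k of (n, m) \<Rightarrow> s n m) \<in> (\<Inter>n. E n)"
      using s by (auto simp: E_def)
    then show "x \<in> fst ` (\<Inter>n. E n)"
      by force
  next
    fix x assume "x \<in> fst ` (\<Inter>n. E n)"
    then show "x \<in> (\<Inter>n. A n)"
      using C(2) by (force simp: E_def)
  qed
  ultimately show ?thesis
    unfolding suslin_def by blast
qed

text \<open>In a metrizable space every open set is a countable union of closed sets.\<close>

lemma openin_imp_suslin:
  assumes "metrizable_space X" and "openin X U"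
  shows "suslin X U"
proof -
  obtain C :: "nat \<Rightarrow> _" where "\<And>n. closedin X (C n)" "\<Union> (range C) = U"
    using open_imp_fsigma_in[OF assms] unfolding fsigma_in_ascending by blast
  then show ?thesis
    using suslin_UN[of X C] closedin_imp_suslin by metis
qed

text \<open>Analytic sets need not be closed under complements, so the induction carries each set
  together with its complement; the complement of a union becomes an intersection.\<close>

lemma borel_imp_suslin:
  assumes "metrizable_space X" and "B \<in> sigma_sets (topspace X) {U. openin X U}"
  shows "suslin X B"
proof -
  have "suslin X B \<and> suslin X (topspace X - B)"
    using assms(2)
  proof induction
    case (Basic U)
    then show ?case
      using openin_imp_suslin[OF assms(1)] closedin_imp_suslin[OF closedin_diff[OF closedin_topspace]] by auto
  next
    case Empty
    show ?case
      using closedin_imp_suslin[of X] by simp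
  next
    case (Compl B)
    then have "B \<subseteq> topspace X"
      using sigma_sets_into_sp[OF _ Compl(1)] openin_subset by blast
    then have "topspace X - (topspace X - B) = B"
      by blast
    then show ?case
      using Compl by simp
  next
    case (Union B)
    then show ?case
      using suslin_UN[of X B] suslin_INT[of X "\<lambda>n. topspace X - B n"] by simp
  qed
  then show ?thesis ..
qed

section \<open>Separating coordinate images of Borel sets of tuples\<close>

text \<open>Each coordinate is continuous, hence Borel measurable, and preimages under coordinates
  generate the product sigma-algebra.\<close>

lemma sets_PiM_subset_sigma_sets_product_topology:
  fixes I :: "'i set"
  assumes "topspace X = space V" and "sets V = sigma_sets (topspace X) {U. openin X U}"
  defines "P \<equiv> product_topology (\<lambda>_. X) I"
  shows "sets (Pi\<^sub>M I (\<lambda>_. V)) \<subseteq> sigma_sets (topspace P) {U. openin P U}"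
proof -
  define S where "S = sigma (topspace P) {U. openin P U}"
  have S: "space S = topspace P" "sets S = sigma_sets (topspace P) {U. openin P U}"
    unfolding S_def using openin_subset[of P] by (auto intro!: space_measure_of sets_measure_of)
  have "(\<lambda>x. x i) \<in> measurable S V" if "i \<in> I" for i
  proof (rule measurable_sigma_sets[OF assms(2)])
    show "{U. openin X U} \<subseteq> Pow (topspace X)"
      using openin_subset by auto
    show "(\<lambda>x. x i) \<in> space S \<rightarrow> topspace X"
      using that by (auto simp: S P_def)
    fix U assume "U \<in> {U. openin X U}"
    then have "openin P {x \<in> topspace P. x i \<in> U}"
      unfolding P_def using that
      by (intro openin_continuous_map_preimage[OF continuous_map_product_projection]) auto
    moreover have "(\<lambda>x. x i) -` U \<inter> space S = {x \<in> topspace P. x i \<in> U}"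
      by (auto simp: S)
    ultimately show "(\<lambda>x. x i) -` U \<inter> space S \<in> sets S"
      by (simp add: S)
  qed
  note meas = this
  have "{x \<in> \<Pi>\<^sub>E i\<in>I. space V. x i \<in> A} \<in> sets S" if "i \<in> I" "A \<in> sets V" for i A
  proof -
    have "{x \<in> \<Pi>\<^sub>E i\<in>I. space V. x i \<in> A} = (\<lambda>x. x i) -` A \<inter> space S"
      by (auto simp: S P_def assms(1))
    then show ?thesis
      using measurable_sets[OF meas that(2)] that(1) by simp
  qed
  moreover have "(\<Pi>\<^sub>E i\<in>I. space V) = topspace P"
    by (simp add: P_def assms(1))
  ultimately show ?thesis
    unfolding sets_PiM_single S(2)[symmetric]
    by (intro sets.sigma_sets_subset') (auto simp: S(1)[symmetric])
qed

text \<open>A measurable set of tuples is the projection of a closed set in the Polish product with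
  Baire space. Composing that projection with a coordinate gives a continuous map, so Lusin
  separation applies.\<close>

lemma component_images_separation:
  fixes I J :: "'i set"
  assumes "standard_borel V" and "countable I" and "countable J" and "i \<in> I" and "j \<in> J"
    and "B \<in> sets (Pi\<^sub>M I (\<lambda>_. V))" and "B' \<in> sets (Pi\<^sub>M J (\<lambda>_. V))"
    and "(\<lambda>c. c i) ` B \<inter> (\<lambda>c. c j) ` B' = {}"
  shows "\<exists>S\<in>sets V. (\<lambda>c. c i) ` B \<subseteq> S \<and> S \<inter> (\<lambda>c. c j) ` B' = {}"
proof -
  obtain X where X: "polish_topology X" "topspace X = space V"
    "sets V = sigma_sets (topspace X) {U. openin X U}"
    using assms(1) unfolding standard_borel_def by blast
  have pol: "polish_topology (product_topology (\<lambda>_. X) K)" if "countable K" for K :: "'i set"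
    using that X(1) by (rule polish_topology_product_topology)
  have closed_image: "\<exists>C. closedin (prod_topology (product_topology (\<lambda>_. X) K) baire) C \<and> D = fst ` C"
    if "countable K" "D \<in> sets (Pi\<^sub>M K (\<lambda>_. V))" for K :: "'i set" and D
  proof -
    have "suslin (product_topology (\<lambda>_. X) K) D"
      using that(2) sets_PiM_subset_sigma_sets_product_topology[OF X(2,3)] pol[OF that(1)]
      by (intro borel_imp_suslin completely_metrizable_imp_metrizable_space) (auto simp: polish_topology_def)
    then show ?thesis
      unfolding suslin_def .
  qed
  have cont: "continuous_map (prod_topology (product_topology (\<lambda>_. X) K) baire) X (\<lambda>q. fst q k)"
    if "k \<in> K" for K and k :: 'i
    using continuous_map_compose[OF continuous_map_fst continuous_map_product_projection[OF that]]
    by (simp add: o_def)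
  obtain C where C: "closedin (prod_topology (product_topology (\<lambda>_. X) I) baire) C" "B = fst ` C"
    using closed_image[OF assms(2,6)] by blast
  obtain D where D: "closedin (prod_topology (product_topology (\<lambda>_. X) J) baire) D" "B' = fst ` D"
    using closed_image[OF assms(3,7)] by blast
  have "Hausdorff_space X"
    using X(1) unfolding polish_topology_def
    by (intro metrizable_imp_Hausdorff_space completely_metrizable_imp_metrizable_space) auto
  then have "\<exists>S\<in>sets V. (\<lambda>q. fst q i) ` C \<subseteq> S \<and> S \<inter> (\<lambda>q. fst q j) ` D = {}"
    using X(3) assms(8) C D cont[OF assms(4)] cont[OF assms(5)]
    by (intro lusin_separation[OF polish_topology_prod_topology[OF pol[OF assms(2)] polish_topology_baire]
          polish_topology_prod_topology[OF pol[OF assms(3)] polish_topology_baire]]) (auto simp: image_image)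
  then show ?thesis
    by (simp add: C D image_image)
qed

section \<open>Peeling off antichains by induction on the height\<close>

lemma finite_chain_has_top:
  assumes "finite C" and "C \<noteq> {}" and "C \<in> Chains r" and "trans r"
  shows "\<exists>x\<in>C. \<forall>y\<in>C. (y, x) \<in> r"
  using assms(1-3)
proof (induction rule: finite_ne_induct)
  case (singleton x)
  then show ?case by (auto simp: Chains_def)
next
  case (insert a C)
  then obtain x where x: "x \<in> C" "\<forall>y\<in>C. (y, x) \<in> r"
    by (auto simp: Chains_def)
  \<comment> \<open>Reflexivity on a chain comes from comparing an element with itself, as
    \<open>Chains\<close> does not demand distinct elements.\<close>
  have "(a, a) \<in> r" "(a, x) \<in> r \<or> (x, a) \<in> r"
    using insert.prems x(1) by (auto simp: Chains_def)
  then show ?case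
    using x \<open>trans r\<close> by (metis insert_iff transD)
qed

text \<open>The converse is the preimage of \<open>r\<close> under the swap of coordinates. For a
  partial order the difference is the strict order, obtained here without the diagonal.\<close>

lemma strict_part_measurable:
  assumes "r \<in> sets (V \<Otimes>\<^sub>M V)"
  shows "r - r\<inverse> \<in> sets (V \<Otimes>\<^sub>M V)"
proof -
  have "r\<inverse> = (\<lambda>(x, y). (y, x)) -` r \<inter> space (V \<Otimes>\<^sub>M V)"
    using sets.sets_into_space[OF assms] by (auto simp: space_pair_measure)
  also have "\<dots> \<in> sets (V \<Otimes>\<^sub>M V)"
    by (rule measurable_sets[OF measurable_pair_swap' assms])
  finally show ?thesis
    using assms by blast
qed

text \<open>The induction ranges over all measurable \<open>W\<close> and bounds chains only from
  above, because removing a layer is known to leave height at most \<open>h\<close>. Some of the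
  antichains may then be empty.\<close>

lemma borel_antichain_decomposition:
  assumes V: "standard_borel V" and po: "partial_order_on (space V) r" and r: "r \<in> sets (V \<Otimes>\<^sub>M V)"
    and "W \<in> sets V" and "\<And>C. C \<in> Chains r \<Longrightarrow> C \<subseteq> W \<Longrightarrow> finite C \<and> card C \<le> h"
  shows "\<exists>A :: nat \<Rightarrow> 'a set. disjoint_family_on A {..<h} \<and> (\<Union>i<h. A i) = W \<and>
    (\<forall>i<h. antichain r (A i) \<and> A i \<in> sets V)"
  using assms(4,5)
proof (induction h arbitrary: W)
  case 0
  have "W = {}"
  proof (rule ccontr)
    assume "W \<noteq> {}"
    then obtain x where "x \<in> W" by blast
    moreover have "(x, x) \<in> r"
      using \<open>x \<in> W\<close> po sets.sets_into_space[OF 0(1)]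
      by (auto simp: partial_order_on_def preorder_on_def refl_on_def)
    ultimately show False
      using 0(2)[of "{x}"] by (auto simp: Chains_def)
  qed
  then show ?case
    by (simp add: disjoint_family_on_def)
next
  case (Suc h)
  have W: "W \<subseteq> space V"
    using Suc.prems(1) by (rule sets.sets_into_space)
  have "trans r" "antisym r" and refl: "\<And>x. x \<in> W \<Longrightarrow> (x, x) \<in> r"
    using po W by (auto simp: partial_order_on_def preorder_on_def refl_on_def)
  let ?P = "\<lambda>n::nat. Pi\<^sub>M {..n} (\<lambda>_. V)"
  define s where "s = r - r\<inverse>"
  have strict: "(x, y) \<in> s \<longleftrightarrow> (x, y) \<in> r \<and> x \<noteq> y" if "x \<in> W" for x y
    using \<open>antisym r\<close> refl that by (auto simp: s_def dest: antisymD)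
  have [measurable]: "Measurable.pred (V \<Otimes>\<^sub>M V) (\<lambda>p. p \<in> r)" "Measurable.pred (V \<Otimes>\<^sub>M V) (\<lambda>p. p \<in> s)"
    "Measurable.pred V (\<lambda>x. x \<in> W)"
    using r strict_part_measurable[OF r] Suc.prems(1) by (simp_all add: s_def[symmetric])
  \<comment> \<open>The tuples in \<open>B\<close> list the chains of size \<open>h + 1\<close> in
    \<open>W\<close> with their top at index \<open>h\<close>; strict comparability forces distinct
    entries. Coordinate 0 of \<open>B'\<close> runs through the non-maximal elements of
    \<open>W\<close>. Both sets are measurable, being cut out by finitely many measurable
    conditions.\<close>
  define B where "B = {c \<in> space (?P h). (\<forall>i\<in>{..h}. c i \<in> W) \<and>
      (\<forall>i\<in>{..h}. \<forall>j\<in>{..h}. i \<noteq> j \<longrightarrow> (c i, c j) \<in> s \<or> (c j, c i) \<in> s) \<and>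
      (\<forall>i\<in>{..h}. (c i, c h) \<in> r)}"
  define B' where "B' = {c \<in> space (?P 1). c 0 \<in> W \<and> c 1 \<in> W \<and> (c 0, c 1) \<in> s}"
  have B: "B \<in> sets (?P h)"
    unfolding B_def by measurable
  have B': "B' \<in> sets (?P 1)"
    unfolding B'_def by measurable
  have Chain: "c ` {..h} \<in> Chains r" "card (c ` {..h}) = Suc h" "c ` {..h} \<subseteq> W"
    "\<And>x. x \<in> c ` {..h} \<Longrightarrow> (x, c h) \<in> r" if "c \<in> B" for c
  proof -
    have "inj_on c {..h}"
      using that by (fastforce simp: B_def inj_on_def s_def)
    then show "card (c ` {..h}) = Suc h"
      by (simp add: card_image)
    show "c ` {..h} \<subseteq> W" and "\<And>x. x \<in> c ` {..h} \<Longrightarrow> (x, c h) \<in> r"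
      using that by (auto simp: B_def)
    have "(c i, c j) \<in> r \<or> (c j, c i) \<in> r" if "i \<le> h" "j \<le> h" for i j
      using that \<open>c \<in> B\<close> refl by (cases "i = j") (auto simp: B_def s_def)
    then show "c ` {..h} \<in> Chains r"
      by (auto simp: Chains_def)
  qed
  \<comment> \<open>A top element strictly below some \<open>y\<close> in \<open>W\<close> would let
    \<open>y\<close> extend its chain to \<open>h + 2\<close> elements.\<close>
  have "(\<lambda>c. c h) ` B \<inter> (\<lambda>c. c 0) ` B' = {}"
  proof (intro equals0I)
    fix x assume "x \<in> (\<lambda>c. c h) ` B \<inter> (\<lambda>c. c 0) ` B'"
    then obtain c y where c: "c \<in> B" "x = c h" and y: "y \<in> W" "(x, y) \<in> r" "(y, x) \<notin> r"
      by (auto simp: B'_def s_def)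
    let ?C = "insert y (c ` {..h})"
    have below: "(z, y) \<in> r" if "z \<in> c ` {..h}" for z
      using Chain(4)[OF c(1) that] y(2) c(2) \<open>trans r\<close> by (metis transD)
    then have "?C \<in> Chains r"
      using Chain(1)[OF c(1)] refl[OF y(1)] unfolding Chains_def by blast
    moreover have "y \<notin> c ` {..h}"
      using Chain(4)[OF c(1)] y(3) c(2) by blast
    ultimately show False
      using Suc.prems(2)[of ?C] Chain(2,3)[OF c(1)] y(1) by simp
  qed
  then have "\<exists>S\<in>sets V. (\<lambda>c. c h) ` B \<subseteq> S \<and> S \<inter> (\<lambda>c. c 0) ` B' = {}"
    by (intro component_images_separation[OF V _ _ _ _ B B']) auto
  then obtain S where S: "S \<in> sets V" "(\<lambda>c. c h) ` B \<subseteq> S" "S \<inter> (\<lambda>c. c 0) ` B' = {}"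
    by blast
  \<comment> \<open>Two distinct comparable points of \<open>W \<inter> S\<close> would form a pair
    in \<open>B'\<close>, putting the lower one into the set that \<open>S\<close> misses. The
    restriction to \<open>{..1}\<close> makes the pair a point of the product space.\<close>
  have anti: "antichain r (W \<inter> S)"
  proof -
    have False if xy: "x \<in> W \<inter> S" "y \<in> W \<inter> S" "x \<noteq> y" "(x, y) \<in> r" for x y
    proof -
      let ?c = "\<lambda>i\<in>{..1::nat}. if i = 0 then x else y"
      have "?c \<in> B'"
        using xy W strict by (auto simp: B'_def space_PiM)
      then have "?c 0 \<in> (\<lambda>c. c 0) ` B'"
        by (rule imageI)
      then show False
        using S(3) xy(1) by auto
    qed
    then show ?thesis
      unfolding antichain_def by metis
  qed
  have less: "finite C \<and> card C \<le> h" if C: "C \<in> Chains r" "C \<subseteq> W - S" for C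
  proof -
    have fin: "finite C" "card C \<le> Suc h"
      using Suc.prems(2)[of C] C by auto
    \<comment> \<open>Only size \<open>h + 1\<close> must be excluded: such a chain, listed with its
      top last, is a tuple in \<open>B\<close>, so its top lies in \<open>S\<close>, contrary to
      \<open>C \<subseteq> W - S\<close>.\<close>
    have "card C \<noteq> Suc h"
    proof
      assume card: "card C = Suc h"
      then have "C \<noteq> {}" by auto
      then obtain x where x: "x \<in> C" "\<forall>y\<in>C. (y, x) \<in> r"
        using finite_chain_has_top[OF fin(1) _ C(1) \<open>trans r\<close>] by blast
      obtain f where f: "bij_betw f {0..<h} (C - {x})"
        using ex_bij_betw_nat_finite[of "C - {x}"] fin(1) card x(1) by auto
      define c where "c = (\<lambda>i\<in>{..h}. if i = h then x else f i)"
      have fC: "f i \<in> C" "f i \<noteq> x" if "i < h" for i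
        using bij_betwE[OF f] that by auto
      then have cC: "c i \<in> C" if "i \<le> h" for i
        using that x(1) by (auto simp: c_def)
      have inj: "c i \<noteq> c j" if "i \<le> h" "j \<le> h" "i \<noteq> j" for i j
        using that fC[of i] fC[of j] inj_onD[OF bij_betw_imp_inj_on[OF f], of i j]
        by (auto simp: c_def le_less)
      have "(c i, c j) \<in> s \<or> (c j, c i) \<in> s" if "i \<le> h" "j \<le> h" "i \<noteq> j" for i j
      proof -
        have "c i \<in> W" "c j \<in> W" "(c i, c j) \<in> r \<or> (c j, c i) \<in> r"
          using cC[OF that(1)] cC[OF that(2)] C by (auto simp: Chains_def)
        then show ?thesis
          using inj[OF that] strict by metis
      qed
      moreover have "c h = x" by (simp add: c_def)
      moreover have "c \<in> space (?P h)"
        using subsetD[OF subset_trans[OF C(2) subset_trans[OF Diff_subset W]]] cC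
        by (auto simp: space_PiM PiE_iff c_def split: if_splits)
      ultimately have "c \<in> B"
        using cC C(2) x(2) unfolding B_def by auto
      then have "x \<in> S"
        using S(2) \<open>c h = x\<close> by blast
      then show False
        using x(1) C(2) by blast
    qed
    then show ?thesis
      using fin by simp
  qed
  obtain A :: "nat \<Rightarrow> 'a set" where A: "disjoint_family_on A {..<h}" "(\<Union>i<h. A i) = W - S"
    "\<forall>i<h. antichain r (A i) \<and> A i \<in> sets V"
    using Suc.IH[of "W - S"] less Suc.prems(1) S(1) by blast
  \<comment> \<open>The new layer takes the fresh index \<open>h\<close>; the earlier ones fill
    \<open>W - S\<close> and hence avoid it.\<close>
  let ?A = "A(h := W \<inter> S)"
  have "A i \<inter> (W \<inter> S) = {}" if "i < h" for i
    using A(2) that by blast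
  then have "disjoint_family_on ?A {..<Suc h}"
    using A(1) unfolding disjoint_family_on_def lessThan_Suc by (simp add: Int_commute)
  moreover have "(\<Union>i<h. ?A i) = (\<Union>i<h. A i)"
    by (intro SUP_cong) auto
  then have "(\<Union>i<Suc h. ?A i) = W"
    unfolding lessThan_Suc using A(2) by auto
  moreover have "\<forall>i<Suc h. antichain r (?A i) \<and> ?A i \<in> sets V"
    using A(3) anti Suc.prems(1) S(1) by (auto simp: less_Suc_eq)
  ultimately show ?case by blast
qed

lemma sets_imp_universally_measurable:
  "A \<in> sets V \<Longrightarrow> universally_measurable V A"
  using sets.sets_into_space by (auto simp: universally_measurable_def intro: sets_completionI_sets)

theorem theorem6:
  fixes V :: "'a measure" and r :: "'a rel" and h :: nat
  assumes "borel_poset V r"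
    and "has_height r h"
  shows "\<exists>A :: nat \<Rightarrow> 'a set.
           disjoint_family_on A {..<h} \<and>
           (\<Union>i<h. A i) = space V \<and>
           (\<forall>i<h. antichain r (A i) \<and> universally_measurable V (A i))"
proof -
  \<comment> \<open>The Borel version is applied with \<open>W = space V\<close>; Borel sets belong
    to every completion.\<close>
  have "\<exists>A :: nat \<Rightarrow> 'a set. disjoint_family_on A {..<h} \<and> (\<Union>i<h. A i) = space V \<and>
    (\<forall>i<h. antichain r (A i) \<and> A i \<in> sets V)"
    using assms by (intro borel_antichain_decomposition) (auto simp: borel_poset_def has_height_def)
  then show ?thesis
    using sets_imp_universally_measurable by meson
qed

end
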